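(* Let $d\ge 2$ and $n\ge 1$, and let $(X_{i1},\ldots,X_{id})$, $i\in\{1,\ldots,n\}$, be observations in $\mathbb{R}^d$ such that for each $j$ there are no ties among $X_{1j},\ldots,X_{nj}$. Then for any degrees $m_1,m_2,\ldots,m_d\in\mathbb{Z}^{+}$, the empirical checkerboard Bernstein copula $C^{\#}_{m,n}$ (defined in the context) is a genuine copula, i.e. it is the restriction to $[0,1]^d$ of the joint cumulative distribution function of a random vector with all univariate marginals uniform on $[0,1]$.
   Context: Let $R^{(n)}_{i,j}$ denote the rank of $X_{ij}$ among $X_{1j},\ldots,X_{nj}$. The empirical checkerboard copula is $$C^{\#}_n(\mathbf{u})=\frac1n\sum_{i=1}^n\prod_{j=1}^d\min\left(\max\left(nu_j-R^{(n)}_{i,j}+1,\,0\right),\,1\right),\qquad \mathbf{u}=(u_1,\ldots,u_d)\in[0,1]^d.$$ For positive integers $m_1,\ldots,m_d$, the empirical checkerboard Bernstein copula (ECBC) with degrees $m=(m_1,\ldots,m_d)$ is $$C^{\#}_{m,n}(\mathbf{u})=\sum_{k_1=0}^{m_1}\cdots\sum_{k_d=0}^{m_d} C^{\#}_n\left(\frac{k_1}{m_1},\ldots,\frac{k_d}{m_d}\right)\prod_{j=1}^d\binom{m_j}{k_j}u_j^{k_j}(1-u_j)^{m_j-k_j}.$$ *)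

theory Defs
  imports "HOL-Probability.Probability"
begin

text \<open>A function on the unit cube is a copula if it is there the joint distribution function of a
  random vector with uniform marginals. The sample space may be taken to be
  \<open>real ^ 'd\<close> without loss of generality: replace a random vector by its law.
  Values of \<open>C\<close> outside the unit cube are irrelevant.\<close>

definition is_copula :: "(real ^ 'd \<Rightarrow> real) \<Rightarrow> bool" where
  "is_copula C \<longleftrightarrow>
    (\<exists>(M :: (real ^ 'd) measure) (U :: real ^ 'd \<Rightarrow> real ^ 'd).
       prob_space M \<and> U \<in> borel_measurable M \<and>
       (\<forall>j. distr M borel (\<lambda>\<omega>. U \<omega> $ j) = uniform_measure lborel {0..1}) \<and>
       (\<forall>u. (\<forall>j. 0 \<le> u $ j \<and> u $ j \<le> 1) \<longrightarrow>
          C u = measure M {\<omega> \<in> space M. \<forall>j. U \<omega> $ j \<le> u $ j}))"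

definition sample_rank :: "nat \<Rightarrow> (nat \<Rightarrow> real ^ 'd) \<Rightarrow> nat \<Rightarrow> 'd \<Rightarrow> nat" where
  "sample_rank n X i j = card {l \<in> {1..n}. X l $ j \<le> X i $ j}"

definition emp_checkerboard_copula ::
  "nat \<Rightarrow> (nat \<Rightarrow> real ^ 'd) \<Rightarrow> real ^ 'd \<Rightarrow> real" where
  "emp_checkerboard_copula n X u =
    1 / real n * (\<Sum>i = 1..n. \<Prod>j \<in> UNIV.
      min (max (real n * u $ j - real (sample_rank n X i j) + 1) 0) 1)"

text \<open>A single sum over multi-indices \<open>k\<close> replaces the nested sums over
  \<open>k\<^sub>1, \<dots>, k\<^sub>d\<close>.\<close>

definition emp_checkerboard_bernstein_copula ::
  "('d \<Rightarrow> nat) \<Rightarrow> nat \<Rightarrow> (nat \<Rightarrow> real ^ 'd) \<Rightarrow> real ^ 'd \<Rightarrow> real" where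
  "emp_checkerboard_bernstein_copula m n X u =
    (\<Sum>k \<in> (\<Pi>\<^sub>E j \<in> UNIV. {0..m j}).
      emp_checkerboard_copula n X (\<chi> j. real (k j) / real (m j)) *
      (\<Prod>j \<in> UNIV. real (m j choose k j) * (u $ j) ^ k j * (1 - u $ j) ^ (m j - k j)))"

end

theory Submission
  imports Defs
begin

text \<open>Interchanging the sum over multi-indices with the product over coordinates writes the ECBC as
  \<open>1/n \<cdot> (\<Sum>i. \<Prod>j. G\<^sub>i\<^sub>j (u\<^sub>j))\<close>, where \<open>G\<^sub>i\<^sub>j\<close> is the Bernstein polynomial of the distribution
  function of the uniform law on the interval \<open>[(R\<^sub>i\<^sub>j - 1)/n, R\<^sub>i\<^sub>j/n]\<close>. Bernstein polynomials
  of increasing functions are increasing and keep the values at the end points, so each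
  \<open>G\<^sub>i\<^sub>j\<close> is a distribution function and the ECBC is the distribution function of a
  uniform mixture of \<open>n\<close> product laws. Without ties the ranks in each coordinate permute
  \<open>{1..n}\<close>, hence the \<open>n\<close> uniform distribution functions average to the identity, which
  Bernstein polynomials reproduce.\<close>

section \<open>Bernstein polynomials\<close>

text \<open>The coefficients form a sequence indexed by \<open>nat\<close>, not a function sampled
  at \<open>k / m\<close>: the same \<open>f\<close> then makes sense in every degree, which
  induction on the degree requires.\<close>

definition bernstein_poly :: "nat \<Rightarrow> (nat \<Rightarrow> real) \<Rightarrow> real \<Rightarrow> real" where
  "bernstein_poly m f x = (\<Sum>k\<le>m. f k * Bernstein m k x)"

lemma Bernstein_Suc_Suc:
  "Bernstein (Suc m) (Suc k) x = x * Bernstein m k x + (1 - x) * Bernstein m (Suc k) x"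
proof (cases "k < m")
  case True
  then have "m - k = Suc (m - Suc k)" by simp
  then show ?thesis by (simp add: Bernstein_def algebra_simps)
qed (simp add: Bernstein_def not_less algebra_simps)

text \<open>This is de Casteljau's recursion. It follows from Pascal's rule for the basis and drives
  the monotonicity proof.\<close>

lemma bernstein_poly_Suc:
  "bernstein_poly (Suc m) f x =
    (1 - x) * bernstein_poly m f x + x * bernstein_poly m (f \<circ> Suc) x"
proof -
  have "bernstein_poly (Suc m) f x =
      f 0 * Bernstein (Suc m) 0 x + (\<Sum>k\<le>m. f (Suc k) * Bernstein (Suc m) (Suc k) x)"
    unfolding bernstein_poly_def by (rule sum.atMost_Suc_shift)
  also have "(\<Sum>k\<le>m. f (Suc k) * Bernstein (Suc m) (Suc k) x) =
      x * bernstein_poly m (f \<circ> Suc) x + (1 - x) * (\<Sum>k\<le>m. f (Suc k) * Bernstein m (Suc k) x)"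
    by (simp add: Bernstein_Suc_Suc bernstein_poly_def sum_distrib_left sum.distrib
        distrib_left mult_ac)
  also have "f 0 * Bernstein (Suc m) 0 x = (1 - x) * (f 0 * Bernstein m 0 x)"
    by (simp add: Bernstein_def)
  also have "\<dots> + (x * bernstein_poly m (f \<circ> Suc) x +
        (1 - x) * (\<Sum>k\<le>m. f (Suc k) * Bernstein m (Suc k) x)) =
      (1 - x) * (\<Sum>k\<le>Suc m. f k * Bernstein m k x) + x * bernstein_poly m (f \<circ> Suc) x"
    unfolding sum.atMost_Suc_shift by (simp add: algebra_simps)
  \<comment> \<open>The extra summand vanishes because \<open>m choose Suc m\<close> is 0.\<close>
  also have "(\<Sum>k\<le>Suc m. f k * Bernstein m k x) = bernstein_poly m f x"
    by (simp add: bernstein_poly_def Bernstein_def)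
  finally show ?thesis .
qed

lemma bernstein_poly_mono_fun:
  assumes "\<And>k. f k \<le> g k" "0 \<le> x" "x \<le> 1"
  shows "bernstein_poly m f x \<le> bernstein_poly m g x"
  unfolding bernstein_poly_def using assms
  by (intro sum_mono mult_right_mono Bernstein_nonneg) auto

text \<open>Induction on the degree along de Casteljau's recursion. Going from \<open>x\<close> to
  \<open>y\<close> first raises both lower-degree polynomials, then moves the weight
  \<open>y - x\<close> from the one for \<open>f\<close> to the one for
  \<open>f \<circ> Suc\<close>, which is larger because \<open>f\<close> increases.\<close>

lemma bernstein_poly_mono:
  assumes "mono f" "0 \<le> x" "x \<le> y" "y \<le> 1"
  shows "bernstein_poly m f x \<le> bernstein_poly m f y"
  using assms(1)
proof (induction m arbitrary: f)
  case 0
  then show ?case by (simp add: bernstein_poly_def Bernstein_def)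
next
  case (Suc m)
  let ?b = "bernstein_poly m f" and ?c = "bernstein_poly m (f \<circ> Suc)"
  have "mono (f \<circ> Suc)"
    using Suc.prems by (auto simp: mono_def)
  then have "(1 - x) * ?b x + x * ?c x \<le> (1 - x) * ?b y + x * ?c y"
    using Suc assms by (intro add_mono mult_left_mono) auto
  moreover have "?b y \<le> ?c y"
    using Suc.prems assms by (intro bernstein_poly_mono_fun) (auto simp: mono_def)
  then have "0 \<le> (y - x) * (?c y - ?b y)"
    using assms by simp
  then have "(1 - x) * ?b y + x * ?c y \<le> (1 - y) * ?b y + y * ?c y"
    by (simp add: algebra_simps)
  ultimately show ?case
    by (simp add: bernstein_poly_Suc)
qed

lemma bernstein_poly_0 [simp]: "bernstein_poly m f 0 = f 0"
proof -
  have "bernstein_poly m f 0 = (\<Sum>k\<le>m. if k = 0 then f 0 else 0)"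
    unfolding bernstein_poly_def by (intro sum.cong) (auto simp: Bernstein_def)
  then show ?thesis by simp
qed

lemma bernstein_poly_1 [simp]: "bernstein_poly m f 1 = f m"
proof -
  have "bernstein_poly m f 1 = (\<Sum>k\<le>m. if k = m then f m else 0)"
    unfolding bernstein_poly_def by (intro sum.cong) (auto simp: Bernstein_def)
  then show ?thesis by simp
qed

lemma continuous_on_bernstein_poly: "continuous_on S (bernstein_poly m f)"
  unfolding bernstein_poly_def[abs_def] Bernstein_def by (intro continuous_intros)

lemma sum_bernstein_poly:
  "(\<Sum>i\<in>I. bernstein_poly m (f i) x) = bernstein_poly m (\<lambda>k. \<Sum>i\<in>I. f i k) x"
  unfolding bernstein_poly_def by (subst sum.swap) (simp add: sum_distrib_right)

text \<open>Up to the factor \<open>c / m\<close>, the sum is the mean \<open>m * x\<close> of the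
  binomial law.\<close>

lemma bernstein_poly_linear:
  assumes "m \<ge> 1"
  shows "bernstein_poly m (\<lambda>k. c * (real k / real m)) x = c * x"
proof -
  have "bernstein_poly m (\<lambda>k. c * (real k / real m)) x =
      c / real m * (\<Sum>k\<le>m. real k * Bernstein m k x)"
    unfolding bernstein_poly_def sum_distrib_left by (intro sum.cong) auto
  then show ?thesis using assms by simp
qed

section \<open>Ranks\<close>

lemma sample_rank_less:
  assumes "l \<in> {1..n}" "X i $ j < X l $ j"
  shows "sample_rank n X i j < sample_rank n X l j"
  unfolding sample_rank_def
proof (rule psubset_card_mono)
  have "l \<in> {k \<in> {1..n}. X k $ j \<le> X l $ j}" "l \<notin> {k \<in> {1..n}. X k $ j \<le> X i $ j}"
    using assms by auto
  moreover have "{k \<in> {1..n}. X k $ j \<le> X i $ j} \<subseteq> {k \<in> {1..n}. X k $ j \<le> X l $ j}"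
    using assms(2) by auto
  ultimately show "{k \<in> {1..n}. X k $ j \<le> X i $ j} \<subset> {k \<in> {1..n}. X k $ j \<le> X l $ j}"
    by blast
qed simp

text \<open>Distinct values have distinct ranks by \<open>sample_rank_less\<close>, and an injective
  self-map of a finite set is onto.\<close>

lemma bij_betw_sample_rank:
  assumes "inj_on (\<lambda>i. X i $ j) {1..n}"
  shows "bij_betw (\<lambda>i. sample_rank n X i j) {1..n} {1..n}"
proof -
  have inj: "inj_on (\<lambda>i. sample_rank n X i j) {1..n}"
  proof (rule inj_onI, rule ccontr)
    fix i l
    assume il: "i \<in> {1..n}" "l \<in> {1..n}" "sample_rank n X i j = sample_rank n X l j" "i \<noteq> l"
    then have "X i $ j \<noteq> X l $ j"
      using assms by (auto dest: inj_onD)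
    then show False
      using sample_rank_less[of l n X i j] sample_rank_less[of i n X l j] il
      by (cases "X i $ j < X l $ j") auto
  qed
  have "sample_rank n X i j \<in> {1..n}" if "i \<in> {1..n}" for i
  proof -
    have "{l \<in> {1..n}. X l $ j \<le> X i $ j} \<noteq> {}"
      using that by auto
    moreover have "card {l \<in> {1..n}. X l $ j \<le> X i $ j} \<le> card {1..n}"
      by (intro card_mono) auto
    ultimately show ?thesis
      by (simp add: sample_rank_def Suc_le_eq card_gt_0_iff)
  qed
  then have "(\<lambda>i. sample_rank n X i j) ` {1..n} = {1..n}"
    using inj by (intro endo_inj_surj) auto
  with inj show ?thesis
    by (simp add: bij_betw_def)
qed

text \<open>The \<open>r\<close>-th summand is the length of the part of \<open>[0, s]\<close>
  inside \<open>[r - 1, r]\<close>; these lengths add up to the length of the part of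
  \<open>[0, s]\<close> inside \<open>[0, N]\<close>.\<close>

lemma sum_clamp_shift:
  fixes s :: real
  assumes "0 \<le> s"
  shows "(\<Sum>r = 1..N. min (max (s - real r + 1) 0) 1) = min s (real N)"
proof (induction N)
  case (Suc N)
  then show ?case by (simp add: min_def max_def)
qed (use assms in simp)

lemma sum_clamp_sample_rank:
  assumes "inj_on (\<lambda>i. X i $ j) {1..n}" "0 \<le> t" "t \<le> 1"
  shows "(\<Sum>i = 1..n. min (max (real n * t - real (sample_rank n X i j) + 1) 0) 1) = real n * t"
proof -
  have "(\<Sum>i = 1..n. min (max (real n * t - real (sample_rank n X i j) + 1) 0) 1) =
      (\<Sum>r = 1..n. min (max (real n * t - real r + 1) 0) 1)"
    by (rule sum.reindex_bij_betw[OF bij_betw_sample_rank[OF assms(1)]])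
  also have "\<dots> = min (real n * t) (real n)"
    using assms by (intro sum_clamp_shift) simp
  also have "\<dots> = real n * t"
    using assms mult_left_mono[of t 1 "real n"] by simp
  finally show ?thesis .
qed

section \<open>Uniform mixtures of product laws\<close>

lemma vec_lambda_measurable:
  assumes "\<And>j. sets (\<nu> j) = sets borel"
  shows "vec_lambda \<in> borel_measurable (Pi\<^sub>M (UNIV :: 'd::finite set) (\<nu> :: 'd \<Rightarrow> real measure))"
proof -
  have "(\<lambda>\<omega>. \<omega> j) \<in> borel_measurable (Pi\<^sub>M UNIV \<nu>)" for j
    using measurable_component_singleton[of j UNIV \<nu>] assms[of j]
    by (simp cong: measurable_cong_sets)
  then show ?thesis
    by (subst borel_measurable_euclidean_space) (auto simp: Basis_vec_def inner_axis)
qed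

lemma box_in_sets_borel:
  fixes A :: "'d::finite \<Rightarrow> real set"
  assumes "\<And>j. A j \<in> sets borel"
  shows "{x :: real ^ 'd. \<forall>j. x $ j \<in> A j} \<in> sets borel"
proof -
  have "(\<lambda>x :: real ^ 'd. x $ j) \<in> borel_measurable borel" for j
    by (intro borel_measurable_continuous_onI continuous_intros)
  then have "Measurable.pred borel (\<lambda>x :: real ^ 'd. \<forall>j. x $ j \<in> A j)"
    using assms by measurable
  then show ?thesis
    by (simp add: pred_def)
qed

text \<open>\<open>Pi\<^sub>M\<close> lives on functions, while copulas are stated for vectors;
  \<open>vec_lambda\<close> transports the product measure.\<close>

definition product_law :: "('d::finite \<Rightarrow> real measure) \<Rightarrow> (real ^ 'd) measure" where
  "product_law \<nu> = distr (Pi\<^sub>M UNIV \<nu>) borel vec_lambda"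

text \<open>Under \<open>vec_lambda\<close> a box pulls back to \<open>Pi\<^sub>E UNIV A\<close>.
  General Borel sides cover both lower orthants, for the joint distribution function, and boxes with
  sides \<open>UNIV\<close>, for the marginals.\<close>

lemma
  fixes \<nu> :: "'d::finite \<Rightarrow> real measure"
  assumes \<nu>: "\<And>j. real_distribution (\<nu> j)"
  shows prob_space_product_law: "prob_space (product_law \<nu>)"
    and measure_product_law:
      "(\<And>j. A j \<in> sets borel) \<Longrightarrow>
        measure (product_law \<nu>) {x. \<forall>j. x $ j \<in> A j} = (\<Prod>j\<in>UNIV. measure (\<nu> j) (A j))"
proof -
  interpret real_distribution "\<nu> j" for j by (rule \<nu>)
  interpret finite_product_prob_space \<nu> UNIV
    by standard auto
  have meas: "vec_lambda \<in> borel_measurable (Pi\<^sub>M UNIV \<nu>)"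
    by (intro vec_lambda_measurable) simp
  show "prob_space (product_law \<nu>)"
    unfolding product_law_def using meas by (rule prob_space_distr)
  assume A: "\<And>j. A j \<in> sets borel"
  have "measure (product_law \<nu>) {x. \<forall>j. x $ j \<in> A j} = measure (Pi\<^sub>M UNIV \<nu>) (Pi\<^sub>E UNIV A)"
    unfolding product_law_def
    by (subst measure_distr[OF meas box_in_sets_borel[OF A]])
      (auto simp: space_PiM intro!: arg_cong[where f = "measure _"])
  also have "\<dots> = (\<Prod>j\<in>UNIV. measure (\<nu> j) (A j))"
    using A by (intro prob_times) simp
  finally show "measure (product_law \<nu>) {x. \<forall>j. x $ j \<in> A j} = (\<Prod>j\<in>UNIV. measure (\<nu> j) (A j))" .
qed

text \<open>Extended by constants outside the unit interval, \<open>G\<close> is increasing and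
  continuous with limits 0 and 1, so its Lebesgue-Stieltjes measure is the required law.\<close>

lemma unit_interval_cdf:
  fixes G :: "real \<Rightarrow> real"
  assumes "mono_on {0..1} G" "continuous_on {0..1} G" "G 0 = 0" "G 1 = 1"
  obtains \<nu> where "real_distribution \<nu>" "\<And>x. measure \<nu> {..x} = G (max 0 (min x 1))"
proof -
  define F where "F x = G (max 0 (min x 1))" for x
  have mono: "F x \<le> F y" if "x \<le> y" for x y
    unfolding F_def using that by (intro mono_onD[OF assms(1)]) auto
  have "continuous_on UNIV F"
    unfolding F_def by (intro continuous_on_compose2[OF assms(2)] continuous_intros) auto
  then have cont: "continuous (at_right a) F" for a
    by (meson UNIV_I continuous_at_imp_continuous_at_within continuous_on_eq_continuous_at open_UNIV)
  have bot: "(F \<longlongrightarrow> 0) at_bot"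
    by (rule tendsto_eventually, rule eventually_at_bot_linorderI[of 0])
      (simp add: F_def assms)
  have top: "(F \<longlongrightarrow> 1) at_top"
    by (rule tendsto_eventually, rule eventually_at_top_linorderI[of 1])
      (simp add: F_def assms)
  show thesis
    using real_distribution_interval_measure[OF mono cont bot top]
      measure_interval_measure_Iic[OF mono cont bot]
    by (intro that[of "interval_measure F"]) (auto simp: F_def)
qed

lemma real_distribution_uniform: "real_distribution (uniform_measure lborel {0..1})"
proof -
  have "prob_space (uniform_measure lborel {0..1::real})"
    by (rule prob_space_uniform_measure) auto
  then show ?thesis
    by (simp add: real_distribution_def real_distribution_axioms_def)
qed

lemma measure_uniform_Iic:
  "measure (uniform_measure lborel {0..1}) {..x} = max 0 (min x (1::real))"
proof -
  have "{0..1} \<inter> {..x} = {0..min x 1}"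
    by auto
  then show ?thesis
    by (simp add: measure_uniform_measure max_def min.commute)
qed

text \<open>Draw \<open>i\<close> uniformly from \<open>{1..n}\<close>, then draw the coordinates
  independently with distribution functions \<open>G i j\<close>. Box probabilities are averages
  over \<open>i\<close> of products; for a single coordinate the average is the identity by
  \<open>avg\<close>.\<close>

lemma is_copula_product_mixture:
  fixes G :: "nat \<Rightarrow> 'd::finite \<Rightarrow> real \<Rightarrow> real" and C :: "real ^ 'd \<Rightarrow> real"
  assumes n: "n \<ge> 1"
    and G: "\<And>i j. i \<in> {1..n} \<Longrightarrow> mono_on {0..1} (G i j)"
      "\<And>i j. i \<in> {1..n} \<Longrightarrow> continuous_on {0..1} (G i j)"
      "\<And>i j. i \<in> {1..n} \<Longrightarrow> G i j 0 = 0" "\<And>i j. i \<in> {1..n} \<Longrightarrow> G i j 1 = 1"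
    and avg: "\<And>j x. 0 \<le> x \<Longrightarrow> x \<le> 1 \<Longrightarrow> (\<Sum>i = 1..n. G i j x) / n = x"
    and C: "\<And>u. (\<And>j. 0 \<le> u $ j \<and> u $ j \<le> 1) \<Longrightarrow> C u = (\<Sum>i = 1..n. \<Prod>j\<in>UNIV. G i j (u $ j)) / n"
  shows "is_copula C"
proof -
  have "\<forall>i\<in>{1..n}. \<forall>j. \<exists>\<nu>. real_distribution \<nu> \<and> (\<forall>x. measure \<nu> {..x} = G i j (max 0 (min x 1)))"
    using G by (metis unit_interval_cdf)
  then obtain \<nu> where \<nu>: "\<And>i j. i \<in> {1..n} \<Longrightarrow> real_distribution (\<nu> i j)"
    and \<nu>_Iic: "\<And>i j x. i \<in> {1..n} \<Longrightarrow> measure (\<nu> i j) {..x} = G i j (max 0 (min x 1))"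
    by metis
  define p where "p = pmf_of_set {1..n}"
  \<comment> \<open>Outside the support of \<open>p\<close> the kernel still has to be a probability measure.\<close>
  define K where "K i = product_law (\<nu> (if i \<in> {1..n} then i else 1))" for i
  define M where "M = measure_pmf p \<bind> K"
  have K_prob: "prob_space (K i)" for i
    unfolding K_def using n by (intro prob_space_product_law \<nu>) auto
  have K_sets: "sets (K i) = sets borel" for i
    by (simp add: K_def product_law_def)
  \<comment> \<open>The index space is discrete, so only the values of \<open>K\<close> have to be
    checked.\<close>
  have K: "K \<in> measurable (measure_pmf p) (subprob_algebra borel)"
    using K_prob K_sets
    by (auto simp: space_subprob_algebra prob_space_imp_subprob_space)
  have M_prob: "prob_space M"
    unfolding M_def using K_prob by (intro measure_pmf.prob_space_bind[OF _ K]) simp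
  have M_sets [measurable_cong]: "sets M = sets borel"
    unfolding M_def by (intro sets_bind) (auto simp: K_sets)
  then have M_space: "space M = UNIV"
    by (metis sets_eq_imp_space_eq space_borel)
  have M_box: "measure M {x. \<forall>j. x $ j \<in> A j} = (\<Sum>i = 1..n. \<Prod>j\<in>UNIV. measure (\<nu> i j) (A j)) / n"
    if A: "\<And>j. A j \<in> sets borel" for A
  proof -
    have "measure M {x. \<forall>j. x $ j \<in> A j} = (\<integral>i. measure (K i) {x. \<forall>j. x $ j \<in> A j} \<partial>p)"
      unfolding M_def using K box_in_sets_borel[OF A] by (rule measure_pmf.measure_bind)
    also have "\<dots> = (\<Sum>i = 1..n. measure (K i) {x. \<forall>j. x $ j \<in> A j}) / n"
      unfolding p_def using n by (subst integral_pmf_of_set) auto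
    also have "(\<Sum>i = 1..n. measure (K i) {x. \<forall>j. x $ j \<in> A j}) =
        (\<Sum>i = 1..n. \<Prod>j\<in>UNIV. measure (\<nu> i j) (A j))"
      using \<nu> A by (intro sum.cong) (auto simp: K_def measure_product_law)
    finally show ?thesis .
  qed
  have nth_meas: "(\<lambda>x. x $ j) \<in> borel_measurable M" for j
    by (subst measurable_cong_sets[OF M_sets refl])
      (intro borel_measurable_continuous_onI continuous_intros)
  have marginal: "distr M borel (\<lambda>x. x $ j) = uniform_measure lborel {0..1}" for j
  proof (rule cdf_unique)
    show "real_distribution (distr M borel (\<lambda>x. x $ j))"
      using prob_space.prob_space_distr[OF M_prob nth_meas]
      by (simp add: real_distribution_def real_distribution_axioms_def)
    show "cdf (distr M borel (\<lambda>x. x $ j)) = cdf (uniform_measure lborel {0..1})"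
    proof
      fix x :: real
      \<comment> \<open>A half-line condition on coordinate \<open>j\<close> is a box whose other
        sides are the whole line and contribute factors 1.\<close>
      define A where "A l = (if l = j then {..x} else UNIV)" for l
      have "cdf (distr M borel (\<lambda>x. x $ j)) x = measure M ((\<lambda>y. y $ j) -` {..x} \<inter> space M)"
        unfolding cdf_def by (rule measure_distr[OF nth_meas]) simp
      also have "(\<lambda>y. y $ j) -` {..x} \<inter> space M = {y. \<forall>l. y $ l \<in> A l}"
        by (auto simp: M_space A_def)
      also have "measure M \<dots> = (\<Sum>i = 1..n. \<Prod>l\<in>UNIV. measure (\<nu> i l) (A l)) / n"
        by (intro M_box) (simp add: A_def)
      also have "(\<Sum>i = 1..n. \<Prod>l\<in>UNIV. measure (\<nu> i l) (A l)) =
          (\<Sum>i = 1..n. G i j (max 0 (min x 1)))"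
      proof (intro sum.cong refl)
        fix i assume i: "i \<in> {1..n}"
        have "measure (\<nu> i l) UNIV = 1" for l
          using \<nu>[OF i, of l] prob_space.prob_space[of "\<nu> i l"]
          by (simp add: real_distribution_def real_distribution.space_eq_univ[OF \<nu>[OF i]])
        then have "(\<Prod>l\<in>UNIV. measure (\<nu> i l) (A l)) =
            (\<Prod>l\<in>UNIV. if l = j then measure (\<nu> i j) {..x} else 1)"
          by (intro prod.cong) (auto simp: A_def)
        then show "(\<Prod>l\<in>UNIV. measure (\<nu> i l) (A l)) = G i j (max 0 (min x 1))"
          by (simp add: \<nu>_Iic[OF i])
      qed
      also have "\<dots> / n = max 0 (min x 1)"
        by (intro avg) auto
      finally show "cdf (distr M borel (\<lambda>x. x $ j)) x = cdf (uniform_measure lborel {0..1}) x"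
        by (simp add: cdf_def measure_uniform_Iic)
    qed
  qed (rule real_distribution_uniform)
  have joint: "C u = measure M {x \<in> space M. \<forall>j. x $ j \<le> u $ j}"
    if u: "\<forall>j. 0 \<le> u $ j \<and> u $ j \<le> 1" for u
  proof -
    have "measure M {x \<in> space M. \<forall>j. x $ j \<le> u $ j} = measure M {x. \<forall>j. x $ j \<in> {..u $ j}}"
      by (simp add: M_space)
    also have "\<dots> = (\<Sum>i = 1..n. \<Prod>j\<in>UNIV. measure (\<nu> i j) {..u $ j}) / n"
      by (rule M_box) simp
    also have "(\<Sum>i = 1..n. \<Prod>j\<in>UNIV. measure (\<nu> i j) {..u $ j}) =
        (\<Sum>i = 1..n. \<Prod>j\<in>UNIV. G i j (u $ j))"
      using u by (intro sum.cong prod.cong) (auto simp: \<nu>_Iic)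
    finally show ?thesis
      using C u by simp
  qed
  \<comment> \<open>The random vector is the identity on the sample space \<open>M\<close>.\<close>
  have "(\<lambda>x. x) \<in> borel_measurable M"
    by measurable
  then show ?thesis
    unfolding is_copula_def using M_prob marginal joint by blast
qed

section \<open>The empirical checkerboard Bernstein copula\<close>

text \<open>For each observation both the checkerboard term and the Bernstein weight factor over the
  coordinates, so \<open>prod_sum_PiE\<close> turns the sum over multi-indices into a product of
  one-dimensional sums.\<close>

lemma emp_checkerboard_bernstein_copula_eq:
  "emp_checkerboard_bernstein_copula m n X u =
    (\<Sum>i = 1..n. \<Prod>j\<in>UNIV. bernstein_poly (m j)
      (\<lambda>k. min (max (real n * (real k / real (m j)) - real (sample_rank n X i j) + 1) 0) 1)
      (u $ j)) / n"
proof -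
  define f where "f i j k =
      min (max (real n * (real k / real (m j)) - real (sample_rank n X i j) + 1) 0) 1" for i j k
  have "emp_checkerboard_bernstein_copula m n X u =
      (\<Sum>k \<in> (\<Pi>\<^sub>E j \<in> UNIV. {0..m j}).
        \<Sum>i = 1..n. (\<Prod>j\<in>UNIV. f i j (k j) * Bernstein (m j) (k j) (u $ j)) / n)"
    unfolding emp_checkerboard_bernstein_copula_def emp_checkerboard_copula_def
    by (simp add: f_def Bernstein_def prod.distrib sum_distrib_right sum_divide_distrib)
  also have "\<dots> = (\<Sum>i = 1..n. (\<Sum>k \<in> (\<Pi>\<^sub>E j \<in> UNIV. {0..m j}).
        \<Prod>j\<in>UNIV. f i j (k j) * Bernstein (m j) (k j) (u $ j)) / n)"
    by (subst sum.swap) (simp add: sum_divide_distrib)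
  also have "\<dots> = (\<Sum>i = 1..n. (\<Prod>j\<in>UNIV. bernstein_poly (m j) (f i j) (u $ j)) / n)"
    by (simp add: bernstein_poly_def prod_sum_PiE atLeast0AtMost)
  finally show ?thesis
    by (simp add: f_def[abs_def] sum_divide_distrib)
qed

theorem mainTheorem2:
  fixes X :: "nat \<Rightarrow> real ^ 'd" and n :: nat and m :: "'d \<Rightarrow> nat"
  assumes "CARD('d) \<ge> 2"
    and "n \<ge> 1"
    and no_ties: "\<And>j. inj_on (\<lambda>i. X i $ j) {1..n}"
    and "\<And>j. m j \<ge> 1"
  shows "is_copula (emp_checkerboard_bernstein_copula m n X)"
proof -
  define f where "f i j k =
      min (max (real n * (real k / real (m j)) - real (sample_rank n X i j) + 1) 0) 1" for i j k
  have rank: "1 \<le> sample_rank n X i j \<and> sample_rank n X i j \<le> n" if "i \<in> {1..n}" for i j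
    using bij_betwE[OF bij_betw_sample_rank[OF no_ties]] that by simp
  have m_pos: "0 < real (m j)" for j
    using assms(4)[of j] by simp
  have f_mono: "mono (f i j)" for i j
  proof (rule monoI)
    fix k l :: nat assume "k \<le> l"
    then have "real n * (real k / real (m j)) \<le> real n * (real l / real (m j))"
      by (intro mult_left_mono divide_right_mono) auto
    then show "f i j k \<le> f i j l"
      by (simp add: f_def min_def max_def)
  qed
  show ?thesis
  proof (rule is_copula_product_mixture[where n = n and G = "\<lambda>i j. bernstein_poly (m j) (f i j)"])
    show "mono_on {0..1} (bernstein_poly (m j) (f i j))" for i j
      by (intro mono_onI bernstein_poly_mono f_mono) auto
    \<comment> \<open>With \<open>R\<close> the rank, the clamped quantity is
      \<open>1 - R \<le> 0\<close> at \<open>k = 0\<close>, and \<open>n - R + 1 \<ge> 1\<close> at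
      \<open>k = m j\<close> in the next claim.\<close>
    show "bernstein_poly (m j) (f i j) 0 = 0" if "i \<in> {1..n}" for i j
      using rank[OF that, of j] by (simp add: f_def)
    show "bernstein_poly (m j) (f i j) 1 = 1" if "i \<in> {1..n}" for i j
      using rank[OF that, of j] m_pos[of j] by (simp add: f_def)
    show "(\<Sum>i = 1..n. bernstein_poly (m j) (f i j) x) / n = x" for j x
    proof -
      \<comment> \<open>The bound on \<open>k\<close> keeps the grid point \<open>k / m j\<close> in
        the unit interval; a Bernstein polynomial of degree \<open>m j\<close> only reads these
        coefficients.\<close>
      have "(\<Sum>i = 1..n. f i j k) = real n * (real k / real (m j))" if "k \<le> m j" for k
        unfolding f_def using that m_pos[of j] by (intro sum_clamp_sample_rank no_ties) auto
      then have "(\<Sum>i = 1..n. bernstein_poly (m j) (f i j) x) =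
          bernstein_poly (m j) (\<lambda>k. real n * (real k / real (m j))) x"
        unfolding sum_bernstein_poly by (simp add: bernstein_poly_def)
      also have "\<dots> = real n * x"
        by (rule bernstein_poly_linear[OF assms(4)])
      finally show ?thesis
        using assms(2) by simp
    qed
  qed (use assms(2) in \<open>simp_all add: continuous_on_bernstein_poly
      emp_checkerboard_bernstein_copula_eq f_def[abs_def]\<close>)
qed

end
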